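(* Let $G$ be a locally compact Hausdorff group with left Haar measure $\mu$ and neutral element $e$, let $1\leqslant p<\infty$, and let $\mathcal{F}\subset L^p(G)$ be $L^p$-equivanishing, i.e. for every $\varepsilon>0$ there exists a compact set $K\subset G$ such that $\int_{G\setminus K}|f(y)|^p\,dy\leqslant\varepsilon$ for all $f\in\mathcal{F}$. If $\phi\in C_c(G)$ is such that $\phi(e)\neq 0$, then the family $\mathcal{F}\star\phi:=\{f\star\phi : f\in\mathcal{F}\}$ is equivanishing, i.e. for every $\varepsilon>0$ there exists a compact set $D\subset G$ such that $|f\star\phi(x)|\leqslant\varepsilon$ for all $x\in G\setminus D$ and $f\in\mathcal{F}$.
   Context: $\mu$ is a left Haar measure on $G$: a nonzero left-invariant Borel measure, finite on compact sets, inner regular on open sets and outer regular on measurable sets; $dy$ denotes integration with respect to $\mu$. $L^p(G)=L^p(G,\mu)$ (complex-valued functions). $C_c(G)$ is the space of continuous complex-valued functions with compact support. Convolution: $f\star\phi(x)=\int_G f(y)\,\phi(y^{-1}x)\,dy$ for $x\in G$. *)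

theory Defs
  imports "HOL-Analysis.Analysis"
begin

text \<open>
  Groups are written additively: \<open>topological_group_add\<close> extends \<open>group_add\<close>, in which addition
  is not assumed to be commutative. Thus the neutral element is \<open>0\<close> and \<open>- y + x\<close> stands for
  the product of the inverse of \<open>y\<close> with \<open>x\<close>; the order of the summands matters.
\<close>

locale left_haar_measure =
  fixes M :: "'a :: {topological_group_add, t2_space} measure"
  assumes sets_eq_borel: "sets M = sets borel"
    and nonzero: "emeasure M (space M) \<noteq> 0"
    and left_invariant: "\<And>g A. A \<in> sets M \<Longrightarrow> emeasure M ((\<lambda>x. g + x) ` A) = emeasure M A"
    and finite_on_compact: "\<And>K. compact K \<Longrightarrow> emeasure M K < \<infinity>"
    and inner_regular_open:
      "\<And>U. open U \<Longrightarrow> emeasure M U = (SUP K \<in> {K. K \<subseteq> U \<and> compact K}. emeasure M K)"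
    and outer_regular:
      "\<And>A. A \<in> sets M \<Longrightarrow> emeasure M A = (INF U \<in> {U. A \<subseteq> U \<and> open U}. emeasure M U)"

text \<open>
  Elements of the Lebesgue space are given by representatives; neither the integrals of
  \<open>\<bar>f\<bar>\<^sup>p\<close> nor the convolution below depends on the choice of representative.
\<close>

definition Lp_space :: "'a measure \<Rightarrow> real \<Rightarrow> ('a \<Rightarrow> complex) set" where
  "Lp_space M p = {f \<in> borel_measurable M. integrable M (\<lambda>x. norm (f x) powr p)}"

definition Cc_space :: "('a :: topological_space \<Rightarrow> complex) set" where
  "Cc_space = {\<phi>. continuous_on UNIV \<phi> \<and> compact (closure {x. \<phi> x \<noteq> 0})}"

definition convolution ::
    "'a :: group_add measure \<Rightarrow> ('a \<Rightarrow> complex) \<Rightarrow> ('a \<Rightarrow> complex) \<Rightarrow> 'a \<Rightarrow> complex" where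
  "convolution M f \<phi> x = (LINT y|M. f y * \<phi> (- y + x))"

definition Lp_equivanishing ::
    "'a :: topological_space measure \<Rightarrow> real \<Rightarrow> ('a \<Rightarrow> complex) set \<Rightarrow> bool" where
  "Lp_equivanishing M p F \<longleftrightarrow>
    (\<forall>\<epsilon>>0. \<exists>K. compact K \<and> (\<forall>f\<in>F. (LINT y:UNIV - K|M. norm (f y) powr p) \<le> \<epsilon>))"

definition equivanishing :: "('a :: topological_space \<Rightarrow> complex) set \<Rightarrow> bool" where
  "equivanishing H \<longleftrightarrow>
    (\<forall>\<epsilon>>0. \<exists>D. compact D \<and> (\<forall>x\<in>UNIV - D. \<forall>h\<in>H. norm (h x) \<le> \<epsilon>))"

end

theory Submission
  imports Defs
begin

text \<open>
  Let \<open>S\<close> be the support of \<open>\<phi>\<close>. The integrand of \<open>f \<star> \<phi>\<close> at \<open>x\<close> lives on \<open>x - S\<close>, a left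
  translate of the compact set \<open>-S\<close>; so the domain of integration has a measure \<open>m\<close> that is
  finite and, by left invariance, the same for every \<open>x\<close>. If \<open>x\<close> lies outside the compact set
  \<open>K + S\<close>, this domain misses \<open>K\<close>, so that \<open>f \<star> \<phi>\<close> at \<open>x\<close> only sees the tail
  of \<open>f\<close> outside \<open>K\<close>. On a set of finite measure the \<open>L\<^sup>p\<close> norm controls the \<open>L\<^sup>1\<close> norm, which
  turns the uniform smallness of the tails into a uniform bound for \<open>f \<star> \<phi>\<close>.

  In place of Hoelder's inequality the comparison of \<open>L\<^sup>1\<close> with \<open>L\<^sup>p\<close> uses the elementary
  estimate \<open>t \<le> c + t\<^sup>p / c\<^sup>p\<^sup>-\<^sup>1\<close> with a threshold \<open>c > 0\<close>. It gives (lemma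
  \<open>norm_convolution_le_tail\<close>)
  \<open>norm (convolution M f \<phi> x) \<le> B * (c * m + I / c powr (p - 1))\<close> with \<open>I\<close> the integral of
  \<open>\<bar>f\<bar>\<^sup>p\<close> over the complement of \<open>K\<close> and \<open>B\<close> a bound for \<open>\<bar>\<phi>\<bar>\<close>; first \<open>c\<close> and then \<open>K\<close>
  can be chosen to make both terms small. The estimate treats \<open>p = 1\<close> and \<open>p > 1\<close> alike.
\<close>

text \<open>
  Values below the threshold \<open>c\<close> are absorbed by the first term; above it,
  \<open>t\<^sup>p = t * t\<^sup>p\<^sup>-\<^sup>1\<close> is at least \<open>t * c\<^sup>p\<^sup>-\<^sup>1\<close>.
\<close>

lemma le_threshold_plus_powr:
  fixes t c p :: real
  assumes "0 \<le> t" "0 < c" "1 \<le> p"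
  shows "t \<le> c + t powr p / c powr (p - 1)"
proof (cases "t \<le> c")
  case True
  then show ?thesis by (simp add: add_increasing2)
next
  case False
  have "t * c powr (p - 1) \<le> t * t powr (p - 1)"
    using False assms by (intro mult_left_mono powr_mono2) auto
  also have "\<dots> = t powr p"
    using False assms by (simp add: powr_mult_base)
  finally have "t \<le> t powr p / c powr (p - 1)"
    using assms by (simp add: pos_le_divide_eq)
  then show ?thesis using assms by linarith
qed

lemma compact_uminus_image:
  fixes S :: "'a :: topological_group_add set"
  assumes "compact S"
  shows "compact (uminus ` S)"
  using assms by (intro compact_continuous_image continuous_intros)

lemma compact_sum_image:
  fixes K S :: "'a :: topological_group_add set"
  assumes "compact K" "compact S"
  shows "compact ((\<lambda>(a, b). a + b) ` (K \<times> S))"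
  unfolding case_prod_beta
  using assms by (intro compact_continuous_image compact_Times continuous_intros)

text \<open>
  A function of compact support is bounded because its values off the support are \<open>0\<close>. The
  bound is taken positive so that one may divide by it.
\<close>

lemma Cc_space_bounded:
  assumes "\<phi> \<in> Cc_space"
  obtains B where "0 < B" "\<And>z. norm (\<phi> z) \<le> B"
proof -
  let ?S = "closure {z. \<phi> z \<noteq> 0}"
  have cont: "continuous_on UNIV \<phi>" and compact: "compact ?S"
    using assms by (simp_all add: Cc_space_def)
  have "compact (\<phi> ` ?S)"
    using continuous_on_subset[OF cont subset_UNIV] compact by (rule compact_continuous_image)
  then have "bounded (\<phi> ` ?S)" by (rule compact_imp_bounded)
  then obtain B where B: "0 < B" "\<forall>w\<in>\<phi> ` ?S. norm w \<le> B"
    unfolding bounded_pos by (elim exE conjE)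
  have "norm (\<phi> z) \<le> B" for z
  proof (cases "\<phi> z = 0")
    case True
    then show ?thesis using B(1) by simp
  next
    case False
    then have "z \<in> ?S" by (intro subsetD[OF closure_subset] CollectI)
    then show ?thesis by (intro bspec[OF B(2)] imageI)
  qed
  with B(1) show thesis by (rule that)
qed

text \<open>
  At a point \<open>x\<close> outside \<open>K + S\<close> the conditions \<open>y \<in> K\<close> and \<open>- y + x \<in> S\<close> exclude each other,
  as \<open>x = y + (- y + x)\<close>. The domain of integration \<open>x - S\<close> is thus a subset of the complement
  of \<open>K\<close>.
\<close>

lemma norm_convolution_le_tail:
  fixes M :: "'a :: {topological_group_add, t2_space} measure"
  assumes "left_haar_measure M"
    and "1 \<le> p" and f: "f \<in> Lp_space M p"
    and "compact K" and "compact S"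
    and support: "\<And>z. z \<notin> S \<Longrightarrow> \<phi> z = 0"
    and bound: "\<And>z. norm (\<phi> z) \<le> B"
    and "0 < c"
    and x: "x \<notin> (\<lambda>(a, b). a + b) ` (K \<times> S)"
  shows "norm (convolution M f \<phi> x)
    \<le> B * (c * measure M (uminus ` S)
           + (LINT y:UNIV - K|M. norm (f y) powr p) / c powr (p - 1))"
proof -
  interpret left_haar_measure M by fact
  define N where "N = uminus ` S"
  define A where "A = (\<lambda>z. x + z) ` N"
  have N: "compact N" unfolding N_def using \<open>compact S\<close> by (rule compact_uminus_image)
  have A: "compact A" unfolding A_def using N
    by (intro compact_continuous_image continuous_intros)
  have sets_N: "N \<in> sets M" and sets_A: "A \<in> sets M" and sets_K: "UNIV - K \<in> sets M"
    using N A \<open>compact K\<close> by (auto simp: sets_eq_borel borel_closed compact_imp_closed)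
  have emeasure_A: "emeasure M A < \<infinity>" using A by (rule finite_on_compact)
  have measure_A: "measure M A = measure M N"
    unfolding measure_def A_def left_invariant[OF sets_N] ..
  have "0 \<le> B" using order_trans[OF norm_ge_zero bound] .
  define T where "T = (\<lambda>y. indicat_real (UNIV - K) y *\<^sub>R norm (f y) powr p)"
  have int_T: "integrable M T"
    unfolding T_def using f sets_K by (intro integrable_mult_indicator) (auto simp: Lp_space_def)
  have int_A: "integrable M (indicat_real A)"
    using sets_A emeasure_A by simp
  define u where "u = (\<lambda>y. B * (c * indicat_real A y + T y / c powr (p - 1)))"
  have "norm (f y * \<phi> (- y + x)) \<le> u y" for y
  proof (cases "- y + x \<in> S")
    case True
    have "y \<notin> K"
    proof
      assume "y \<in> K"
      with True have "(\<lambda>(a, b). a + b) (y, - y + x) \<in> (\<lambda>(a, b). a + b) ` (K \<times> S)"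
        by (intro imageI SigmaI)
      with x show False by simp
    qed
    moreover have "x + - (- y + x) = y" by (simp only: minus_add add_minus_cancel minus_minus)
    then have "y \<in> A" unfolding A_def N_def
      using imageI[OF imageI[OF True], of "\<lambda>z. x + z" uminus] by (simp only:)
    ultimately have u: "u y = B * (c + norm (f y) powr p / c powr (p - 1))"
      by (simp add: u_def T_def)
    have "norm (f y * \<phi> (- y + x)) \<le> norm (f y) * B"
      unfolding norm_mult by (intro mult_left_mono bound) simp
    also have "\<dots> \<le> (c + norm (f y) powr p / c powr (p - 1)) * B"
      using assms \<open>0 \<le> B\<close> by (intro mult_right_mono le_threshold_plus_powr) auto
    finally show ?thesis by (simp add: u mult.commute)
  next
    case False
    then show ?thesis
      using support \<open>0 \<le> B\<close> \<open>0 < c\<close> by (simp add: u_def T_def)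
  qed
  moreover have "integrable M u"
    unfolding u_def using int_A int_T by (intro integrable_mult_right integrable_add) auto
  moreover have "0 \<le> u y" for y
    using \<open>0 \<le> B\<close> \<open>0 < c\<close> by (simp add: u_def T_def)
  ultimately have "(LINT y|M. norm (f y * \<phi> (- y + x))) \<le> integral\<^sup>L M u"
    by (intro integral_mono') auto
  then have "norm (convolution M f \<phi> x) \<le> integral\<^sup>L M u"
    unfolding convolution_def by (rule order_trans[OF integral_norm_bound])
  also have "integral\<^sup>L M u = B * (c * measure M A + integral\<^sup>L M T / c powr (p - 1))"
    using int_A int_T sets_A sets.sets_into_space[OF sets_A] by (simp add: u_def Int_absorb2)
  finally show ?thesis
    by (simp add: measure_A N_def T_def set_lebesgue_integral_def)
qed

theorem theorem9:
  fixes M :: "'a :: {topological_group_add, t2_space} measure"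
    and p :: real
    and F :: "('a \<Rightarrow> complex) set"
    and \<phi> :: "'a \<Rightarrow> complex"
  assumes "locally_compact_space (euclidean :: 'a topology)"
    and "left_haar_measure M"
    and "1 \<le> p"
    and "F \<subseteq> Lp_space M p"
    and "Lp_equivanishing M p F"
    and "\<phi> \<in> Cc_space"
    and "\<phi> 0 \<noteq> 0"
  shows "equivanishing ((\<lambda>f. convolution M f \<phi>) ` F)"
proof -
  define S where "S = closure {z. \<phi> z \<noteq> 0}"
  have "compact S" using assms(6) by (simp add: S_def Cc_space_def)
  have support: "\<phi> z = 0" if "z \<notin> S" for z
    using that closure_subset[of "{z. \<phi> z \<noteq> 0}"] by (auto simp: S_def)
  obtain B where "0 < B" and bound: "\<And>z. norm (\<phi> z) \<le> B"
    using Cc_space_bounded[OF assms(6)] by blast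
  define m where "m = measure M (uminus ` S)"
  have "0 \<le> m" by (simp add: m_def)
  have "\<exists>D. compact D \<and> (\<forall>x\<in>UNIV - D. \<forall>f\<in>F. norm (convolution M f \<phi> x) \<le> \<epsilon>)"
    if "0 < \<epsilon>" for \<epsilon>
  proof -
    \<comment> \<open>The values of \<open>c\<close> and \<open>\<delta>\<close> make each of the two terms in the bound at most \<open>\<epsilon> / 2\<close>;
      the summand \<open>1\<close> provides for \<open>m = 0\<close>.\<close>
    define c where "c = \<epsilon> / (2 * B * (m + 1))"
    define \<delta> where "\<delta> = \<epsilon> * c powr (p - 1) / (2 * B)"
    have "0 < c" using that \<open>0 < B\<close> \<open>0 \<le> m\<close> by (simp add: c_def)
    have "0 < \<delta>" using that \<open>0 < B\<close> \<open>0 < c\<close> by (simp add: \<delta>_def)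
    with assms(5) have "\<exists>K. compact K \<and> (\<forall>f\<in>F. (LINT y:UNIV - K|M. norm (f y) powr p) \<le> \<delta>)"
      unfolding Lp_equivanishing_def by (elim allE impE)
    then obtain K where "compact K"
      and K: "\<And>f. f \<in> F \<Longrightarrow> (LINT y:UNIV - K|M. norm (f y) powr p) \<le> \<delta>"
      by (elim exE conjE) (rule that, assumption, erule bspec)
    have "norm (convolution M f \<phi> x) \<le> \<epsilon>"
      if "f \<in> F" and x: "x \<notin> (\<lambda>(a, b). a + b) ` (K \<times> S)" for f x
    proof -
      have "f \<in> Lp_space M p" using that assms(4) by blast
      then have "norm (convolution M f \<phi> x)
          \<le> B * (c * m + (LINT y:UNIV - K|M. norm (f y) powr p) / c powr (p - 1))"
        unfolding m_def
        using assms(2,3) \<open>compact K\<close> \<open>compact S\<close> support bound \<open>0 < c\<close> x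
        by (intro norm_convolution_le_tail)
      also have "\<dots> \<le> B * (c * (m + 1) + \<delta> / c powr (p - 1))"
        using \<open>0 < B\<close> \<open>0 < c\<close> K[OF \<open>f \<in> F\<close>]
        by (intro mult_left_mono add_mono divide_right_mono) auto
      also have "\<dots> = B * (c * (m + 1)) + B * (\<delta> / c powr (p - 1))"
        by (rule distrib_left)
      also have "B * (c * (m + 1)) = \<epsilon> / 2"
        using \<open>0 < B\<close> \<open>0 \<le> m\<close> by (simp add: c_def)
      also have "B * (\<delta> / c powr (p - 1)) = \<epsilon> / 2"
        using \<open>0 < B\<close> \<open>0 < c\<close> by (simp add: \<delta>_def)
      finally show ?thesis by simp
    qed
    with compact_sum_image[OF \<open>compact K\<close> \<open>compact S\<close>] show ?thesis by blast
  qed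
  then show ?thesis unfolding equivanishing_def by simp
qed

end
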